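(* Let $n\ge 2$ and let $m_1,\dots,m_n>0$ be masses in $\mathbb{S}^3$. Let $X\in\mathcal{A}\subset\Delta_+$. Then there is a neighborhood of $X$ in $(\mathbb{S}^3)^n$ in which there is no ordinary central configuration for the masses $m_1,\dots,m_n$.
   Context: $\mathbb{S}^3$ is the unit sphere in $\mathbb{R}^4$ with coordinates $(x,y,z,w)$; the distance $d_{ij}$ between $\mathbf q_i,\mathbf q_j\in\mathbb{S}^3$ is given by $\cos d_{ij}=\mathbf q_i\cdot\mathbf q_j$, $d_{ij}\in[0,\pi]$. A configuration is $\mathbf q=(\mathbf q_1,\dots,\mathbf q_n)$, $\mathbf q_i=(x_i,y_i,z_i,w_i)\in\mathbb{S}^3$. The singular set is $\Delta_+=\bigcup_{i<j}\{\mathbf q\in(\mathbb{S}^3)^n:\mathbf q_i=\pm\mathbf q_j\}$. The potential on $(\mathbb{S}^3)^n\setminus\Delta_+$ is $U_1(\mathbf q)=\sum_{i<j}m_im_j\cot d_{ij}$, and $I_1(\mathbf q)=\sum_i m_i(x_i^2+y_i^2)$. A central configuration is a $\mathbf q\in(\mathbb{S}^3)^n\setminus\Delta_+$ that is a critical point of $U_1-\lambda I_1$ for some $\lambda\in\mathbb{R}$ (the multiplier); it is called ordinary if it is not a critical point of $U_1$. Set $\mathbb{S}^1_{xy}=\{(x,y,z,w)\in\mathbb{S}^3:z=w=0\}$ and $\mathbb{S}^1_{zw}=\{(x,y,z,w)\in\mathbb{S}^3:x=y=0\}$. For $X=(\mathbf q_1',\dots,\mathbf q_n')\in\Delta_+$,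 partition $\{1,\dots,n\}$ into blocks by the equivalence relation $i\sim j\iff \mathbf q_i'=\pm\mathbf q_j'$; each block splits into (at most) two clusters, the indices in one cluster having equal positions and the two clusters having antipodal positions (one of the two clusters may be empty). The set $\mathcal A$ consists of all $X\in\Delta_+$ such that: (1) not all of the points $\mathbf q_1',\dots,\mathbf q_n'$ lie on $\mathbb{S}^1_{xy}\cup\mathbb{S}^1_{zw}$; and (2) there is a block which either has one cluster with at least $2$ elements and the other cluster empty (collision singular sub-configuration), or has both clusters consisting of exactly one element (antipodal singular sub-configuration). *)

theory Defs
  imports "HOL-Analysis.Analysis"
begin

text \<open>The \<open>n\<close> bodies are indexed by a finite linearly ordered type \<open>'n\<close>, so \<open>n = CARD('n)\<close>; the order
  only serves to write sums over \<open>i < j\<close>. The coordinates \<open>(x, y, z, w)\<close> of a point \<open>p\<close> are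
  \<open>p $ 1, p $ 2, p $ 3, p $ 4\<close>.\<close>

type_synonym 'n config = "real ^ 4 ^ 'n"

abbreviation S3 :: "(real ^ 4) set"
  where "S3 \<equiv> sphere 0 1"

definition S3n :: "'n::finite config set"
  where "S3n = {q. \<forall>i. q $ i \<in> S3}"

definition S1xy :: "(real ^ 4) set"
  where "S1xy = {p \<in> S3. p $ 3 = 0 \<and> p $ 4 = 0}"

definition S1zw :: "(real ^ 4) set"
  where "S1zw = {p \<in> S3. p $ 1 = 0 \<and> p $ 2 = 0}"

definition sdist :: "real ^ 4 \<Rightarrow> real ^ 4 \<Rightarrow> real"
  where "sdist p p' = arccos (p \<bullet> p')"

definition singular_set :: "'n::{finite,linorder} config set"
  where "singular_set = (\<Union>i. \<Union>j\<in>{i<..}. {q \<in> S3n. q $ i = q $ j \<or> q $ i = - q $ j})"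

definition U1 :: "('n::{finite,linorder} \<Rightarrow> real) \<Rightarrow> 'n config \<Rightarrow> real"
  where "U1 m q = (\<Sum>(i, j)\<in>{(i, j). i < j}. m i * m j * cot (sdist (q $ i) (q $ j)))"

definition I1 :: "('n::finite \<Rightarrow> real) \<Rightarrow> 'n config \<Rightarrow> real"
  where "I1 m q = (\<Sum>i\<in>UNIV. m i * ((q $ i $ 1)\<^sup>2 + (q $ i $ 2)\<^sup>2))"

text \<open>The tangent space of \<open>S3n\<close> at \<open>q\<close>, hence also that of its open subset \<open>S3n - singular_set\<close>.\<close>

definition tangent_space :: "'n::finite config \<Rightarrow> 'n config set"
  where "tangent_space q = {v. \<forall>i. q $ i \<bullet> v $ i = 0}"

text \<open>Critical points of functions on the manifold \<open>S3n - singular_set\<close>. Only the values of \<open>f\<close> on the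
  manifold matter: a derivative within the manifold is determined exactly on the tangent space.\<close>

definition critical_point :: "('n::{finite,linorder} config \<Rightarrow> real) \<Rightarrow> 'n config \<Rightarrow> bool"
  where "critical_point f q \<longleftrightarrow> q \<in> S3n - singular_set \<and>
    (\<exists>D. (f has_derivative D) (at q within S3n - singular_set) \<and> (\<forall>v\<in>tangent_space q. D v = 0))"

definition central_configuration :: "('n::{finite,linorder} \<Rightarrow> real) \<Rightarrow> 'n config \<Rightarrow> bool"
  where "central_configuration m q \<longleftrightarrow> (\<exists>c::real. critical_point (\<lambda>p. U1 m p - c * I1 m p) q)"

definition ordinary_central_configuration :: "('n::{finite,linorder} \<Rightarrow> real) \<Rightarrow> 'n config \<Rightarrow> bool"
  where "ordinary_central_configuration m q \<longleftrightarrow>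
    central_configuration m q \<and> \<not> critical_point (U1 m) q"

definition block_rel :: "'n::finite config \<Rightarrow> ('n \<times> 'n) set"
  where "block_rel q = {(i, j). q $ i = q $ j \<or> q $ i = - q $ j}"

lemma equiv_block_rel: "equiv UNIV (block_rel q)"
  by (rule equivI) (auto simp: block_rel_def refl_on_def sym_def trans_def)

definition blocks :: "'n::finite config \<Rightarrow> 'n set set"
  where "blocks q = UNIV // block_rel q"

text \<open>For \<open>i\<close> in a block \<open>B\<close>, the two clusters of \<open>B\<close> are \<open>cluster q B (q $ i)\<close> and
  \<open>cluster q B (- q $ i)\<close>; the choice of \<open>i\<close> only affects which of them comes first.\<close>

definition cluster :: "'n::finite config \<Rightarrow> 'n set \<Rightarrow> real ^ 4 \<Rightarrow> 'n set"
  where "cluster q B p = {j \<in> B. q $ j = p}"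

definition collision_block :: "'n::finite config \<Rightarrow> 'n set \<Rightarrow> bool"
  where "collision_block q B \<longleftrightarrow>
    (\<exists>i\<in>B. card (cluster q B (q $ i)) \<ge> 2 \<and> cluster q B (- q $ i) = {})"

definition antipodal_block :: "'n::finite config \<Rightarrow> 'n set \<Rightarrow> bool"
  where "antipodal_block q B \<longleftrightarrow>
    (\<exists>i\<in>B. card (cluster q B (q $ i)) = 1 \<and> card (cluster q B (- q $ i)) = 1)"

definition A_set :: "'n::{finite,linorder} config set"
  where "A_set = {X \<in> singular_set. \<not> (\<forall>i. X $ i \<in> S1xy \<union> S1zw) \<and>
    (\<exists>B\<in>blocks X. collision_block X B \<or> antipodal_block X B)}"

end

theory Submission
  imports Defs
begin

text \<open>
  Near \<open>X\<close> no configuration \<open>q\<close> can be central: the multiplier of such a \<open>q\<close> would stay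
  bounded, while a singular block of the required kind contains a body that is pulled with a force
  tending to infinity. Three ingredients make this precise.

  The first is the balance of forces. At a critical point of \<open>U1 m - c * I1 m\<close> the derivatives of
  \<open>U1\<close> and of \<open>c * I1\<close> agree along every tangent vector (\<open>stationarity_equation\<close>). As
  \<open>cot \<circ> arccos\<close> has derivative \<open>1 / sin\<^sup>3\<close> of the distance, every pair of bodies contributes
  an explicit force.

  The second bounds \<open>c\<close> (\<open>multiplier_bound\<close>). Pick a body \<open>k\<close> with \<open>X $ k\<close> off the two circles
  and rotate the whole block of \<open>k\<close> infinitesimally. Rotations preserve distances, so the
  interactions inside the block, singular though they are, do no work. The pairs in different blocks
  of \<open>X\<close> stay away from the singular set and do bounded work. Off the two circles some rotation
  changes \<open>x\<^sup>2 + y\<^sup>2\<close> at first order, and since this function is even, both clusters of the block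
  contribute to \<open>I1\<close> with the same sign. The derivative of \<open>I1\<close> is therefore bounded away from 0,
  and \<open>c\<close> is bounded.

  The third produces the contradiction (\<open>near_collision_estimate\<close>). In a collision block take
  \<open>a\<close> and \<open>b\<close> at maximal distance, in an antipodal block take its two bodies, and move \<open>a\<close> towards
  \<open>b\<close>. By the maximality no other body of the block resists this motion
  (\<open>eventually_pulled_pair\<close>). With \<open>s = sin d\<^sub>a\<^sub>b\<close> and a tangent vector of length \<open>s\<close>, body \<open>b\<close>
  contributes \<open>m a * m b / s\<close>, while the external forces and the multiplier term are of order \<open>s\<close>.
  This is impossible once \<open>s\<close> is small.
\<close>

section \<open>The force between two bodies\<close>

text \<open>The derivative of \<open>cot \<circ> arccos\<close>; for \<open>u = cos d\<close> it is \<open>1 / sin d ^ 3\<close>.\<close>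

definition cot_rate :: "real \<Rightarrow> real"
  where "cot_rate u = 1 / sqrt (1 - u\<^sup>2) ^ 3"

text \<open>The symmetric bilinear form of \<open>x\<^sup>2 + y\<^sup>2\<close>, so that \<open>2 * xy_inner p v\<close> is the derivative of
  \<open>x\<^sup>2 + y\<^sup>2\<close> at \<open>p\<close> in direction \<open>v\<close>.\<close>

definition xy_inner :: "real ^ 4 \<Rightarrow> real ^ 4 \<Rightarrow> real"
  where "xy_inner p v = p $ 1 * v $ 1 + p $ 2 * v $ 2"

abbreviation pairs :: "('n::linorder \<times> 'n) set"
  where "pairs \<equiv> {(i, j). i < j}"

lemma abs_inner_less_1_iff:
  assumes "p \<in> S3" "p' \<in> S3"
  shows "\<bar>p \<bullet> p'\<bar> < 1 \<longleftrightarrow> p \<noteq> p' \<and> p \<noteq> - p'"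
proof -
  have "\<bar>p \<bullet> p'\<bar> \<le> 1"
    using assms Cauchy_Schwarz_ineq2[of p p'] by simp
  moreover have "\<bar>p \<bullet> p'\<bar> = 1 \<longleftrightarrow> p' = p \<or> p' = - p"
    using assms norm_cauchy_schwarz_abs_eq[of p p'] by simp
  ultimately show ?thesis
    by (auto simp: less_le)
qed

lemma cot_rate_nonneg: "\<bar>u\<bar> \<le> 1 \<Longrightarrow> 0 \<le> cot_rate u"
  by (simp add: cot_rate_def abs_square_le_1)

lemma has_real_derivative_cot_arccos:
  assumes "\<bar>u\<bar> < 1"
  shows "((\<lambda>x. cot (arccos x)) has_real_derivative cot_rate u) (at u)"
proof -
  have u: "- 1 < u" "u < 1" using assms by auto
  have s: "sin (arccos u) = sqrt (1 - u\<^sup>2)" "sqrt (1 - u\<^sup>2) \<noteq> 0"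
    using u assms by (auto simp: sin_arccos abs_square_less_1 power2_eq_1_iff)
  show ?thesis
    using DERIV_chain2[OF DERIV_cot DERIV_arccos[OF u]] s
    by (simp add: cot_rate_def power3_eq_cube power2_eq_square divide_inverse mult.assoc)
qed

lemma not_singular_abs_inner:
  assumes "q \<in> S3n - singular_set" "i \<noteq> j"
  shows "\<bar>q $ i \<bullet> q $ j\<bar> < 1"
proof -
  have "q $ k \<noteq> q $ l \<and> q $ k \<noteq> - q $ l" if "k < l" for k l
    using assms that by (force simp: singular_set_def)
  then have "q $ i \<noteq> q $ j \<and> q $ i \<noteq> - q $ j"
    using assms(2) by (metis linorder_neqE minus_minus)
  then show ?thesis
    using assms abs_inner_less_1_iff[of "q $ i" "q $ j"] by (auto simp: S3n_def)
qed

section \<open>Stationarity along tangent vectors\<close>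

text \<open>The manifold \<open>S3n - singular_set\<close> is open in \<open>S3n\<close>, so a curve in \<open>S3n\<close> starting in it stays
  in it for a short time.\<close>

lemma eventually_not_singular:
  assumes "q \<in> S3n - singular_set"
  shows "\<forall>\<^sub>F p in nhds q. p \<in> S3n \<longrightarrow> p \<notin> singular_set"
proof -
  have "\<forall>\<^sub>F p in nhds q. \<forall>i j. i < j \<longrightarrow> p $ i \<noteq> p $ j \<and> p $ i \<noteq> - p $ j"
  proof (intro eventually_all_finite)
    fix i j
    have "open {p :: 'a config. i < j \<longrightarrow> p $ i \<noteq> p $ j \<and> p $ i \<noteq> - p $ j}"
      by (intro open_Collect_imp open_Collect_conj open_Collect_neq closed_Collect_const
          continuous_intros)
    moreover have "i < j \<longrightarrow> q $ i \<noteq> q $ j \<and> q $ i \<noteq> - q $ j"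
      using assms by (force simp: singular_set_def)
    ultimately show "\<forall>\<^sub>F p in nhds q. i < j \<longrightarrow> p $ i \<noteq> p $ j \<and> p $ i \<noteq> - p $ j"
      using eventually_nhds_in_open by fastforce
  qed
  then show ?thesis
    by eventually_elim (auto simp: singular_set_def)
qed

lemma has_vector_derivative_vec:
  fixes g :: "real \<Rightarrow> 'b::euclidean_space ^ 'n"
  assumes "\<And>i. ((\<lambda>t. g t $ i) has_vector_derivative v $ i) (at t)"
  shows "(g has_vector_derivative v) (at t)"
  unfolding has_vector_derivative_def
proof (subst has_derivative_componentwise_within, intro ballI)
  fix b :: "'b ^ 'n"
  assume "b \<in> Basis"
  then obtain i u where b: "b = axis i u" by (auto simp: Basis_vec_def)
  show "((\<lambda>s. g s \<bullet> b) has_derivative (\<lambda>s. s *\<^sub>R v \<bullet> b)) (at t)"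
    using has_derivative_inner_left[OF assms[unfolded has_vector_derivative_def], of i u]
    by (simp add: b inner_axis)
qed

text \<open>The straight line \<open>q + t v\<close> projected back radially to the spheres. For \<open>q\<close> in \<open>S3n\<close> and \<open>v\<close>
  tangent at \<open>q\<close>, the denominator is the norm of the \<open>i\<close>-th component.\<close>

definition radial_path :: "'n::finite config \<Rightarrow> 'n config \<Rightarrow> real \<Rightarrow> 'n config"
  where "radial_path q v t = (\<chi> i. (1 / sqrt (1 + t\<^sup>2 * (v $ i \<bullet> v $ i))) *\<^sub>R (q $ i + t *\<^sub>R v $ i))"

lemma radial_path_0 [simp]: "radial_path q v 0 = q"
  by (simp add: radial_path_def vec_eq_iff)

lemma radial_path_in_S3n:
  assumes "q \<in> S3n" "v \<in> tangent_space q"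
  shows "radial_path q v t \<in> S3n"
  unfolding S3n_def
proof (safe)
  fix i
  have "q $ i \<bullet> q $ i = 1" "q $ i \<bullet> v $ i = 0"
    using assms by (auto simp: S3n_def tangent_space_def dot_square_norm)
  then have "(norm (q $ i + t *\<^sub>R v $ i))\<^sup>2 = 1 + t\<^sup>2 * (v $ i \<bullet> v $ i)"
    unfolding power2_norm_eq_inner
    by (simp add: inner_add inner_commute power2_eq_square)
  then have "norm (q $ i + t *\<^sub>R v $ i) = sqrt (1 + t\<^sup>2 * (v $ i \<bullet> v $ i))"
    by (metis norm_ge_zero real_sqrt_unique)
  moreover have "0 < 1 + t\<^sup>2 * (v $ i \<bullet> v $ i)"
    by (simp add: add_pos_nonneg)
  ultimately show "radial_path q v t $ i \<in> S3"
    by (simp add: radial_path_def)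
qed

lemma radial_path_vector_derivative:
  "(radial_path q v has_vector_derivative v) (at 0)"
proof (rule has_vector_derivative_vec)
  fix i
  have "((\<lambda>t. 1 / sqrt (1 + t\<^sup>2 * (v $ i \<bullet> v $ i))) has_real_derivative 0) (at 0)"
    by (auto intro!: derivative_eq_intros)
  moreover have "((\<lambda>t. q $ i + t *\<^sub>R v $ i) has_vector_derivative v $ i) (at 0)"
    by (auto intro!: derivative_eq_intros)
  ultimately show "((\<lambda>t. radial_path q v t $ i) has_vector_derivative v $ i) (at 0)"
    using has_vector_derivative_scaleR by (fastforce simp: radial_path_def)
qed

lemma has_real_derivative_inner_path:
  fixes a b :: "real \<Rightarrow> 'b::real_inner"
  assumes "(a has_vector_derivative a') (at t)" "(b has_vector_derivative b') (at t)"
  shows "((\<lambda>s. a s \<bullet> b s) has_real_derivative (a t \<bullet> b' + b t \<bullet> a')) (at t)"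
  using bounded_bilinear.has_vector_derivative[OF bounded_bilinear_inner assms]
  by (simp add: has_real_derivative_iff_has_vector_derivative inner_commute)

text \<open>Both sides are derivatives along the radial path of \<open>v\<close>: the chain rule for the derivative within
  the manifold, which vanishes on \<open>v\<close>, is compared with the termwise derivative of the sums that define
  \<open>U1\<close> and \<open>I1\<close>.\<close>

lemma stationarity_equation:
  fixes m :: "'n::{finite,linorder} \<Rightarrow> real"
  assumes crit: "critical_point (\<lambda>p. U1 m p - c * I1 m p) q"
    and v: "v \<in> tangent_space q"
  shows "(\<Sum>(i, j)\<in>pairs. m i * m j * cot_rate (q $ i \<bullet> q $ j) * (q $ i \<bullet> v $ j + q $ j \<bullet> v $ i))
    = 2 * c * (\<Sum>i\<in>UNIV. m i * xy_inner (q $ i) (v $ i))"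
    (is "?dU = 2 * c * ?dI")
proof -
  let ?f = "\<lambda>p. U1 m p - c * I1 m p" and ?S = "S3n - singular_set" and ?g = "radial_path q v"
  have q: "q \<in> ?S" using crit by (simp add: critical_point_def)
  obtain D where D: "(?f has_derivative D) (at q within ?S)" and D0: "D v = 0"
    using crit v by (auto simp: critical_point_def)
  have gv: "(?g has_vector_derivative v) (at 0)" by (rule radial_path_vector_derivative)
  have comp: "((\<lambda>t. ?g t $ i) has_vector_derivative v $ i) (at 0)" for i
    using bounded_linear.has_vector_derivative[OF bounded_linear_vec_nth gv] .
  have "(?g \<longlongrightarrow> q) (nhds 0)"
    using has_vector_derivative_continuous[OF gv] tendsto_at_iff_tendsto_nhds[of ?g 0]
    by (simp add: continuous_at)
  then have "\<forall>\<^sub>F t in nhds 0. ?g t \<in> S3n \<longrightarrow> ?g t \<notin> singular_set"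
    by (rule eventually_compose_filterlim[OF eventually_not_singular[OF q]])
  then obtain T where T: "open T" "0 \<in> T" "\<And>t. t \<in> T \<Longrightarrow> ?g t \<in> ?S"
    using radial_path_in_S3n[OF _ v] q unfolding eventually_nhds by blast
  have "((?f \<circ> ?g) has_vector_derivative D v) (at 0 within T)"
  proof (rule vector_derivative_diff_chain_within)
    have "?g ` T \<subseteq> ?S" using T(3) by blast
    then show "(?f has_derivative D) (at (?g 0) within ?g ` T)"
      using has_derivative_subset[OF D] by simp
  qed (rule has_vector_derivative_at_within[OF gv])
  then have zero: "((\<lambda>t. ?f (?g t)) has_real_derivative 0) (at 0)"
    unfolding D0 at_within_open[OF T(2,1)] o_def has_real_derivative_iff_has_vector_derivative .
  have "((\<lambda>t. U1 m (?g t)) has_real_derivative ?dU) (at 0)"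
    unfolding U1_def case_prod_unfold
  proof (rule DERIV_sum)
    fix ij :: "'n \<times> 'n"
    assume "ij \<in> {p. fst p < snd p}"
    then have "\<bar>q $ fst ij \<bullet> q $ snd ij\<bar> < 1"
      using not_singular_abs_inner[OF q, of "fst ij" "snd ij"] by auto
    then have "((\<lambda>t. cot (sdist (?g t $ fst ij) (?g t $ snd ij))) has_real_derivative
        cot_rate (q $ fst ij \<bullet> q $ snd ij) * (q $ fst ij \<bullet> v $ snd ij + q $ snd ij \<bullet> v $ fst ij)) (at 0)"
      unfolding sdist_def
      using DERIV_chain2[OF has_real_derivative_cot_arccos
          has_real_derivative_inner_path[OF comp[of "fst ij"] comp[of "snd ij"]]] by simp
    from DERIV_cmult[OF this, of "m (fst ij) * m (snd ij)"]
    show "((\<lambda>t. m (fst ij) * m (snd ij) * cot (sdist (?g t $ fst ij) (?g t $ snd ij))) has_real_derivative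
        m (fst ij) * m (snd ij) * cot_rate (q $ fst ij \<bullet> q $ snd ij) *
        (q $ fst ij \<bullet> v $ snd ij + q $ snd ij \<bullet> v $ fst ij)) (at 0)"
      by (simp add: mult.assoc)
  qed
  moreover have "((\<lambda>t. I1 m (?g t)) has_real_derivative 2 * ?dI) (at 0)"
  proof -
    have coord: "((\<lambda>t. ?g t $ i $ k) has_real_derivative v $ i $ k) (at 0)" for i k
      using bounded_linear.has_vector_derivative[OF bounded_linear_vec_nth comp[of i], of k]
      unfolding has_real_derivative_iff_has_vector_derivative .
    show ?thesis
      unfolding I1_def sum_distrib_left
      by (rule DERIV_sum)
        (auto intro!: derivative_eq_intros coord simp: xy_inner_def algebra_simps)
  qed
  ultimately have "((\<lambda>t. ?f (?g t)) has_real_derivative (?dU - c * (2 * ?dI))) (at 0)"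
    by (intro DERIV_diff DERIV_cmult)
  from DERIV_unique[OF this zero] show ?thesis by simp
qed

section \<open>Pairs in different blocks\<close>

lemma isCont_cot_rate: "\<bar>u\<bar> < 1 \<Longrightarrow> isCont cot_rate u"
  unfolding cot_rate_def
  by (intro continuous_intros) (auto simp: power2_eq_1_iff)

text \<open>The interaction between different blocks of \<open>X\<close>, evaluated at a nearby configuration \<open>q\<close>. The
  blocks are those of \<open>X\<close> and do not vary with \<open>q\<close>, so this stays bounded as \<open>q\<close> tends to \<open>X\<close>.\<close>

definition external_strength :: "('n::{finite,linorder} \<Rightarrow> real) \<Rightarrow> 'n config \<Rightarrow> 'n config \<Rightarrow> real"
  where "external_strength m X q = (\<Sum>(i, j)\<in>pairs.
    if (i, j) \<in> block_rel X then 0 else m i * m j * cot_rate (q $ i \<bullet> q $ j))"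

lemma tendsto_external_strength:
  assumes "X \<in> S3n"
  shows "(external_strength m X \<longlongrightarrow> external_strength m X X) (nhds X)"
proof -
  have "isCont (external_strength m X) X"
    unfolding external_strength_def case_prod_unfold
  proof (rule continuous_sum)
    fix ij :: "'a \<times> 'a"
    let ?i = "fst ij" and ?j = "snd ij"
    show "isCont (\<lambda>q. if (?i, ?j) \<in> block_rel X then 0
        else m ?i * m ?j * cot_rate (q $ ?i \<bullet> q $ ?j)) X"
    proof (cases "(?i, ?j) \<in> block_rel X")
      case False
      then have "\<bar>X $ ?i \<bullet> X $ ?j\<bar> < 1"
        using assms abs_inner_less_1_iff[of "X $ ?i" "X $ ?j"] by (auto simp: S3n_def block_rel_def)
      then have "isCont (\<lambda>q. cot_rate (q $ ?i \<bullet> q $ ?j)) X"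
        by (intro isCont_o2[OF _ isCont_cot_rate] continuous_intros)
      with False show ?thesis by (simp add: continuous_intros)
    qed simp
  qed
  then show ?thesis
    by (simp add: isCont_def tendsto_at_iff_tendsto_nhds)
qed

section \<open>Rotating a block bounds the multiplier\<close>

text \<open>The skew map \<open>e f\<^sup>T - f e\<^sup>T\<close>, an infinitesimal rotation in the plane of \<open>e\<close> and \<open>f\<close>.\<close>

definition turn :: "'a::real_inner \<Rightarrow> 'a \<Rightarrow> 'a \<Rightarrow> 'a"
  where "turn e f p = (f \<bullet> p) *\<^sub>R e - (e \<bullet> p) *\<^sub>R f"

lemma turn_skew: "p \<bullet> turn e f q = - (q \<bullet> turn e f p)"
  by (simp add: turn_def inner_diff_right inner_commute)

lemma abs_inner_turn_le:
  assumes "norm e \<le> 1" "norm f \<le> 1" "norm p = 1" "norm q = 1"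
  shows "\<bar>p \<bullet> turn e f q\<bar> \<le> 2"
proof -
  have le: "\<bar>g \<bullet> r\<bar> \<le> 1" if "norm g \<le> 1" "norm r = 1" for g r :: 'a
    using Cauchy_Schwarz_ineq2[of g r] that by simp
  have "\<bar>(f \<bullet> q) * (e \<bullet> p)\<bar> \<le> 1" "\<bar>(e \<bullet> q) * (f \<bullet> p)\<bar> \<le> 1"
    unfolding abs_mult using le assms by (auto intro!: mult_le_one)
  then show ?thesis
    by (simp add: turn_def inner_diff_right inner_commute)
qed

lemma block_rel_sym: "(i, j) \<in> block_rel X \<longleftrightarrow> (j, i) \<in> block_rel X"
  by (auto simp: block_rel_def)

lemma in_block_iff:
  assumes "B \<in> blocks X" "i \<in> B"
  shows "j \<in> B \<longleftrightarrow> (i, j) \<in> block_rel X"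
proof -
  obtain k where "B = block_rel X `` {k}"
    using assms(1) by (auto simp: blocks_def elim: quotientE)
  moreover from this have "(k, i) \<in> block_rel X" using assms(2) by simp
  ultimately show ?thesis
    using equiv_class_eq[OF equiv_block_rel] by blast
qed

lemma pair_weight_nonneg:
  fixes m :: "'n::{finite,linorder} \<Rightarrow> real"
  assumes "\<And>i. m i > 0" "q \<in> S3n - singular_set" "i \<noteq> j"
  shows "0 \<le> m i * m j * cot_rate (q $ i \<bullet> q $ j)"
  using assms(1)[of i] assms(1)[of j] not_singular_abs_inner[OF assms(2,3)]
  by (intro mult_nonneg_nonneg cot_rate_nonneg) auto

text \<open>The tangent vector is \<open>turn e f\<close> on the bodies of the block \<open>B\<close> and 0 elsewhere. By skewness a
  pair inside \<open>B\<close> contributes nothing, and nor does a pair outside. Only pairs between \<open>B\<close> and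
  its complement remain, and these are among the pairs counted by \<open>external_strength\<close>. The bound
  is useful where the sum on the left stays away from 0.\<close>

lemma multiplier_bound:
  fixes m :: "'n::{finite,linorder} \<Rightarrow> real"
  assumes m: "\<And>i. m i > 0"
    and crit: "critical_point (\<lambda>p. U1 m p - c * I1 m p) q"
    and B: "B \<in> blocks X"
    and ef: "norm e \<le> 1" "norm f \<le> 1"
  shows "\<bar>c\<bar> * \<bar>\<Sum>i\<in>B. m i * xy_inner (q $ i) (turn e f (q $ i))\<bar> \<le> external_strength m X q"
proof -
  have q: "q \<in> S3n - singular_set" using crit by (simp add: critical_point_def)
  then have nq: "norm (q $ i) = 1" for i by (simp add: S3n_def)
  define v where "v = (\<chi> i. if i \<in> B then turn e f (q $ i) else 0)"
  have skew0: "q $ i \<bullet> turn e f (q $ i) = 0" for i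
    using turn_skew[of "q $ i" e f "q $ i"] by simp
  have "v \<in> tangent_space q"
    by (simp add: tangent_space_def v_def skew0)
  note eq = stationarity_equation[OF crit this]
  have "(\<Sum>i\<in>UNIV. m i * xy_inner (q $ i) (v $ i)) =
      (\<Sum>i\<in>B. m i * xy_inner (q $ i) (turn e f (q $ i)))"
    by (rule sum.mono_neutral_cong_right) (auto simp: v_def xy_inner_def)
  then have "2 * (\<bar>c\<bar> * \<bar>\<Sum>i\<in>B. m i * xy_inner (q $ i) (turn e f (q $ i))\<bar>) =
      \<bar>\<Sum>(i, j)\<in>pairs. m i * m j * cot_rate (q $ i \<bullet> q $ j) * (q $ i \<bullet> v $ j + q $ j \<bullet> v $ i)\<bar>"
    unfolding eq by (simp add: abs_mult)
  also have "\<dots> \<le> (\<Sum>(i, j)\<in>pairs. 2 * (if (i, j) \<in> block_rel X then 0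
      else m i * m j * cot_rate (q $ i \<bullet> q $ j)))"
  proof (intro order_trans[OF sum_abs] sum_mono, clarsimp, intro conjI impI)
    fix i j :: 'n
    assume "i < j"
    assume "(i, j) \<in> block_rel X"
    then have "i \<in> B \<longleftrightarrow> j \<in> B"
      using in_block_iff[OF B] by (metis block_rel_sym)
    then show "m i = 0 \<or> m j = 0 \<or> cot_rate (q $ i \<bullet> q $ j) = 0 \<or>
        q $ i \<bullet> v $ j + q $ j \<bullet> v $ i = 0"
      using turn_skew[of "q $ i" e f "q $ j"] by (simp add: v_def)
  next
    fix i j :: 'n
    assume ij: "i < j" "(i, j) \<notin> block_rel X"
    then have "\<not> (i \<in> B \<and> j \<in> B)"
      using in_block_iff[OF B] by blast
    then have "\<bar>q $ i \<bullet> v $ j + q $ j \<bullet> v $ i\<bar> \<le> 2"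
      using abs_inner_turn_le[OF ef nq nq, of i j] abs_inner_turn_le[OF ef nq nq, of j i]
      by (auto simp: v_def)
    moreover have w: "0 \<le> m i * m j * cot_rate (q $ i \<bullet> q $ j)"
      using pair_weight_nonneg[of m q i j, OF m q] ij by simp
    ultimately show "\<bar>m i * m j * cot_rate (q $ i \<bullet> q $ j) * (q $ i \<bullet> v $ j + q $ j \<bullet> v $ i)\<bar>
        \<le> 2 * (m i * m j * cot_rate (q $ i \<bullet> q $ j))"
      unfolding abs_mult[of _ "_ + _"] abs_of_nonneg[OF w] mult.commute[of 2] by (rule mult_left_mono)
  qed
  also have "\<dots> = 2 * external_strength m X q"
    by (simp add: external_strength_def sum_distrib_left case_prod_unfold)
  finally show ?thesis by simp
qed

text \<open>Rotating the \<open>zw\<close>-part of \<open>p\<close> towards its \<open>xy\<close>-part increases \<open>x\<^sup>2 + y\<^sup>2\<close>, to first order unless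
  one of the two parts is 0, that is, unless \<open>p\<close> is on one of the two circles.\<close>

lemma ex_turn_xy_inner_pos:
  assumes "p \<in> S3" "p \<notin> S1xy \<union> S1zw"
  obtains e f where "norm e \<le> 1" "norm f \<le> 1" "0 < xy_inner p (turn e f p)"
proof
  define e f :: "real ^ 4" where "e = (\<chi> k. if k = 1 \<or> k = 2 then p $ k else 0)"
    and "f = (\<chi> k. if k = 1 \<or> k = 2 then 0 else p $ k)"
  have "norm e \<le> norm p" "norm f \<le> norm p"
    by (rule norm_le_componentwise_cart; simp add: e_def f_def)+
  then show "norm e \<le> 1" "norm f \<le> 1" using assms by simp_all
  have "xy_inner p (turn e f p) = ((p $ 3)\<^sup>2 + (p $ 4)\<^sup>2) * ((p $ 1)\<^sup>2 + (p $ 2)\<^sup>2)"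
    by (simp add: xy_inner_def turn_def e_def f_def inner_vec_def sum_4 power2_eq_square algebra_simps)
  moreover have "0 < (p $ 3)\<^sup>2 + (p $ 4)\<^sup>2" "0 < (p $ 1)\<^sup>2 + (p $ 2)\<^sup>2"
    using assms by (auto simp: S1xy_def S1zw_def sum_power2_gt_zero_iff)
  ultimately show "0 < xy_inner p (turn e f p)" by simp
qed

section \<open>The pull inside a singular block\<close>

lemma abs_xy_inner_le: "\<bar>xy_inner p v\<bar> \<le> norm p * norm v"
proof -
  define r :: "real ^ 4" where "r = (\<chi> k. if k = 1 \<or> k = 2 then p $ k else 0)"
  have "norm r \<le> norm p"
    by (rule norm_le_componentwise_cart) (simp add: r_def)
  moreover have "xy_inner p v = r \<bullet> v"
    by (simp add: xy_inner_def r_def inner_vec_def sum_4)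
  ultimately show ?thesis
    using Cauchy_Schwarz_ineq2[of r v] mult_right_mono[of "norm r" "norm p" "norm v"] by simp
qed

text \<open>Body \<open>a\<close> is moved along the component \<open>u\<close> of \<open>q $ b\<close> tangent at \<open>q $ a\<close>, a vector of length
  \<open>s = sin d\<^sub>a\<^sub>b\<close>. The force of \<open>b\<close> does work \<open>m a * m b * s\<^sup>2 / s\<^sup>3\<close>, and the assumption \<open>pull\<close>
  says exactly that the other bodies of the block do nonnegative work. External forces do work at least
  \<open>- s * external_strength m X q\<close> and the multiplier term is at most \<open>2 * \<bar>c\<bar> * m a * s\<close>. Multiplying
  by \<open>s\<close> gives the estimate. For bounded \<open>c\<close> its right-hand side tends to 0 at \<open>X\<close>.\<close>

lemma near_collision_estimate:
  fixes m :: "'n::{finite,linorder} \<Rightarrow> real"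
  assumes m: "\<And>i. m i > 0"
    and crit: "critical_point (\<lambda>p. U1 m p - c * I1 m p) q"
    and ab: "a \<noteq> b" "(a, b) \<in> block_rel X"
    and pull: "\<And>j. (a, j) \<in> block_rel X \<Longrightarrow> j \<noteq> a \<Longrightarrow>
      (q $ j \<bullet> q $ a) * (q $ a \<bullet> q $ b) \<le> q $ j \<bullet> q $ b"
  shows "m a * m b \<le> (1 - (q $ a \<bullet> q $ b)\<^sup>2) * (external_strength m X q + 2 * \<bar>c\<bar> * m a)"
proof -
  have q: "q \<in> S3n - singular_set" using crit by (simp add: critical_point_def)
  then have nq: "norm (q $ i) = 1" for i by (simp add: S3n_def)
  then have qq: "q $ i \<bullet> q $ i = 1" for i by (simp add: dot_square_norm)
  define s where "s = sqrt (1 - (q $ a \<bullet> q $ b)\<^sup>2)"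
  have s: "s > 0" "s\<^sup>2 = 1 - (q $ a \<bullet> q $ b)\<^sup>2"
    using not_singular_abs_inner[OF q ab(1)] by (auto simp: s_def abs_square_less_1 less_imp_le)
  define u where "u = q $ b - (q $ a \<bullet> q $ b) *\<^sub>R q $ a"
  have ju: "q $ j \<bullet> u = q $ j \<bullet> q $ b - (q $ j \<bullet> q $ a) * (q $ a \<bullet> q $ b)" for j
    by (simp add: u_def inner_diff_right)
  have "u \<bullet> u = s\<^sup>2"
    by (simp add: s(2)) (simp add: u_def inner_diff_right inner_diff_left qq inner_commute power2_eq_square)
  then have nu: "norm u = s"
    using s(1) by (simp add: norm_eq_sqrt_inner)
  define v where "v = (\<chi> i. if i = a then u else 0)"
  have "v \<in> tangent_space q"
    using ju[of a] by (auto simp: tangent_space_def v_def qq)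
  note eq = stationarity_equation[OF crit this]
  define F where "F k = m a * m k * cot_rate (q $ a \<bullet> q $ k)" for k
  have F0: "0 \<le> F k" if "k \<noteq> a" for k
    unfolding F_def using pair_weight_nonneg[of m q a k, OF m q] that by simp
  have "q $ b \<bullet> u = s\<^sup>2"
    by (simp add: ju qq s(2) inner_commute[of "q $ b"]) (simp add: power2_eq_square)
  moreover have "cot_rate (q $ a \<bullet> q $ b) = 1 / s ^ 3"
    by (simp add: cot_rate_def s_def)
  ultimately have Fb: "F b * (q $ b \<bullet> u) = m a * m b / s"
    using s(1) by (simp add: F_def field_simps power3_eq_cube power2_eq_square)
  \<comment> \<open>A lower bound for the work done on \<open>a\<close> by a single body \<open>k\<close>: the singular gain from \<open>b\<close>, a nonnegative
    amount from the rest of the block, and a loss of at most \<open>s * F k\<close> from outside.\<close>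
  have force: "(if k = b then m a * m b / s else 0) - s * (if (a, k) \<in> block_rel X then 0 else F k)
      \<le> F k * (q $ k \<bullet> u)" if "k \<noteq> a" for k
  proof (cases "(a, k) \<in> block_rel X")
    case True
    then have "0 \<le> q $ k \<bullet> u" using pull that by (simp add: ju)
    with True F0[OF that] Fb show ?thesis by simp
  next
    case False
    have "- s \<le> q $ k \<bullet> u"
      using Cauchy_Schwarz_ineq2[of "q $ k" u] by (simp add: nq nu)
    from mult_left_mono[OF this F0[OF that]] False ab show ?thesis by (auto simp: mult.commute)
  qed
  \<comment> \<open>The gain from \<open>b\<close> is carried by the ordered pair that consists of \<open>a\<close> and \<open>b\<close>.\<close>
  have "m a * m b / s - s * external_strength m X q =
      (\<Sum>(i, j)\<in>pairs. (if (i, j) = (min a b, max a b) then m a * m b / s else 0)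
        - s * (if (i, j) \<in> block_rel X then 0 else m i * m j * cot_rate (q $ i \<bullet> q $ j)))"
  proof -
    have "(min a b, max a b) \<in> pairs" using ab(1) by (auto simp: min_def max_def)
    then have "(\<Sum>(i, j)\<in>pairs. if (i, j) = (min a b, max a b) then m a * m b / s else 0) = m a * m b / s"
      using sum.delta[of pairs "(min a b, max a b)" "\<lambda>_. m a * m b / s"]
      by (simp add: case_prod_unfold prod_eq_iff)
    then show ?thesis
      by (simp add: case_prod_unfold sum_subtractf external_strength_def sum_distrib_left)
  qed
  also have "\<dots> \<le> (\<Sum>(i, j)\<in>pairs. m i * m j * cot_rate (q $ i \<bullet> q $ j)
      * (q $ i \<bullet> v $ j + q $ j \<bullet> v $ i))"
  proof (rule sum_mono, clarsimp simp only: mem_Collect_eq case_prod_conv)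
    fix i j :: 'n
    assume ij: "i < j"
    consider (first) "i = a" | (second) "j = a" | (neither) "i \<noteq> a" "j \<noteq> a" by blast
    then show "(if (i, j) = (min a b, max a b) then m a * m b / s else 0)
        - s * (if (i, j) \<in> block_rel X then 0 else m i * m j * cot_rate (q $ i \<bullet> q $ j))
        \<le> m i * m j * cot_rate (q $ i \<bullet> q $ j) * (q $ i \<bullet> v $ j + q $ j \<bullet> v $ i)"
    proof cases
      case first
      then have eqv: "(i, j) = (min a b, max a b) \<longleftrightarrow> j = b" using ij by (auto simp: min_def max_def)
      have "j \<noteq> a" using first ij by simp
      then have pull_j: "m i * m j * cot_rate (q $ i \<bullet> q $ j) = F j" "q $ i \<bullet> v $ j + q $ j \<bullet> v $ i = q $ j \<bullet> u"
        using first by (simp_all add: F_def v_def)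
      show ?thesis
        using force[OF \<open>j \<noteq> a\<close>] unfolding eqv pull_j unfolding first .
    next
      case second
      then have eqv: "(i, j) = (min a b, max a b) \<longleftrightarrow> i = b" using ij by (auto simp: min_def max_def)
      have "i \<noteq> a" using second ij by simp
      then have pull_i: "m i * m j * cot_rate (q $ i \<bullet> q $ j) = F i" "q $ i \<bullet> v $ j + q $ j \<bullet> v $ i = q $ i \<bullet> u"
        using second by (simp_all add: F_def v_def inner_commute)
      show ?thesis
        using force[OF \<open>i \<noteq> a\<close>] unfolding eqv pull_i block_rel_sym[of i j] unfolding second .
    next
      case neither
      then have eqv: "(i, j) = (min a b, max a b) \<longleftrightarrow> False" by (auto simp: min_def max_def)
      have "0 \<le> s * (m i * m j * cot_rate (q $ i \<bullet> q $ j))"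
        using pair_weight_nonneg[of m q i j, OF m q] s(1) ij by (intro mult_nonneg_nonneg[of s]) auto
      then show ?thesis unfolding eqv using neither by (simp add: v_def)
    qed
  qed
  also have "\<dots> = 2 * c * (m a * xy_inner (q $ a) u)"
  proof -
    have "(\<Sum>i\<in>UNIV. m i * xy_inner (q $ i) (v $ i)) = (\<Sum>i\<in>{a}. m i * xy_inner (q $ i) (v $ i))"
      by (rule sum.mono_neutral_right) (auto simp: v_def xy_inner_def)
    then show ?thesis unfolding eq by (simp add: v_def)
  qed
  also have "\<dots> \<le> 2 * \<bar>c\<bar> * m a * s"
  proof -
    have "c * xy_inner (q $ a) u \<le> \<bar>c\<bar> * s"
      using abs_xy_inner_le[of "q $ a" u] abs_le_D1[of "c * xy_inner (q $ a) u"]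
        mult_left_mono[of "\<bar>xy_inner (q $ a) u\<bar>" s "\<bar>c\<bar>"]
      by (simp add: nq nu abs_mult)
    from mult_left_mono[OF this, of "2 * m a"] m[of a] show ?thesis by (simp add: mult_ac)
  qed
  finally have "m a * m b / s \<le> s * (external_strength m X q + 2 * \<bar>c\<bar> * m a)"
    by (simp add: algebra_simps)
  then have "m a * m b \<le> s\<^sup>2 * (external_strength m X q + 2 * \<bar>c\<bar> * m a)"
    using s(1) by (simp add: pos_divide_le_eq power2_eq_square mult_ac)
  then show ?thesis by (simp add: s(2))
qed

text \<open>In a collision block all inner products are close to 1. If \<open>a\<close> and \<open>b\<close> minimise the inner product
  over distinct bodies, then \<open>q $ j \<bullet> q $ b\<close> is at least \<open>q $ a \<bullet> q $ b\<close>, and multiplying this positive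
  number by \<open>q $ j \<bullet> q $ a \<le> 1\<close> only decreases it. An antipodal block has no third body, and for
  \<open>j = b\<close> the inequality is Cauchy-Schwarz.\<close>

lemma eventually_pulled_pair:
  fixes X :: "'n::{finite,linorder} config"
  assumes X: "X \<in> S3n" and B: "B \<in> blocks X" and sing: "collision_block X B \<or> antipodal_block X B"
  shows "\<forall>\<^sub>F q in nhds X. q \<in> S3n \<longrightarrow> (\<exists>a\<in>B. \<exists>b\<in>B. a \<noteq> b \<and>
    (\<forall>j\<in>B. j \<noteq> a \<longrightarrow> (q $ j \<bullet> q $ a) * (q $ a \<bullet> q $ b) \<le> q $ j \<bullet> q $ b))"
  using sing
proof
  assume "collision_block X B"
  then obtain i where i: "i \<in> B" "card (cluster X B (X $ i)) \<ge> 2" "cluster X B (- X $ i) = {}"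
    by (auto simp: collision_block_def)
  have eq: "X $ j = X $ i" if "j \<in> B" for j
    using in_block_iff[OF B i(1), of j] that i(3) by (auto simp: block_rel_def cluster_def)
  then have "cluster X B (X $ i) = B" by (auto simp: cluster_def)
  with i(2) have card: "card B \<ge> 2" by simp
  have "\<forall>\<^sub>F q in nhds X. \<forall>j\<in>B. \<forall>k\<in>B. 0 < q $ j \<bullet> q $ k"
  proof (intro eventually_ball_finite ballI finite)
    fix j k
    assume jk: "j \<in> B" "k \<in> B"
    have "X $ j \<bullet> X $ k = 1"
      using X eq jk by (simp add: S3n_def dot_square_norm)
    moreover have "open {q :: 'n config. 0 < q $ j \<bullet> q $ k}"
      by (intro open_Collect_less continuous_intros)
    ultimately show "\<forall>\<^sub>F q in nhds X. 0 < q $ j \<bullet> q $ k"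
      using eventually_nhds_in_open by fastforce
  qed
  then show ?thesis
  proof (eventually_elim, intro impI)
    fix q
    assume pos: "\<forall>j\<in>B. \<forall>k\<in>B. 0 < q $ j \<bullet> q $ k" and q: "q \<in> S3n"
    define P where "P = {(a, b). a \<in> B \<and> b \<in> B \<and> a \<noteq> b}"
    have "P \<noteq> {}"
      using card unfolding card_2_iff' P_def by (auto simp: numeral_2_eq_2 card_le_Suc_iff)
    then obtain p where "is_arg_min (\<lambda>(a, b). q $ a \<bullet> q $ b) (\<lambda>p. p \<in> P) p"
      using ex_is_arg_min_if_finite[OF finite] by blast
    then obtain a b where p: "(a, b) \<in> P"
      and min: "\<And>j k. (j, k) \<in> P \<Longrightarrow> q $ a \<bullet> q $ b \<le> q $ j \<bullet> q $ k"
      by (cases p) (force simp: is_arg_min_linorder)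
    have q1: "q $ j \<bullet> q $ k \<le> 1" for j k
      using q Cauchy_Schwarz_ineq2[of "q $ j" "q $ k"] by (simp add: S3n_def)
    show "\<exists>a\<in>B. \<exists>b\<in>B. a \<noteq> b \<and>
      (\<forall>j\<in>B. j \<noteq> a \<longrightarrow> (q $ j \<bullet> q $ a) * (q $ a \<bullet> q $ b) \<le> q $ j \<bullet> q $ b)"
    proof (intro bexI conjI ballI impI)
      fix j
      assume j: "j \<in> B" "j \<noteq> a"
      have "(q $ j \<bullet> q $ a) * (q $ a \<bullet> q $ b) \<le> q $ a \<bullet> q $ b"
        using pos p q1[of j a] by (simp add: P_def mult_left_le_one_le less_imp_le j)
      also have "\<dots> \<le> q $ j \<bullet> q $ b"
      proof (cases "j = b")
        case True
        then show ?thesis using q q1[of a b] by (simp add: S3n_def dot_square_norm)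
      next
        case False
        then show ?thesis using min[of j b] p j by (simp add: P_def)
      qed
      finally show "(q $ j \<bullet> q $ a) * (q $ a \<bullet> q $ b) \<le> q $ j \<bullet> q $ b" .
    qed (use p in \<open>auto simp: P_def\<close>)
  qed
next
  assume "antipodal_block X B"
  then obtain i a b where i: "i \<in> B" and ab: "cluster X B (X $ i) = {a}" "cluster X B (- X $ i) = {b}"
    by (auto simp: antipodal_block_def card_1_singleton_iff)
  have "X $ i \<bullet> X $ i = 1" using X by (simp add: S3n_def dot_square_norm)
  moreover have "X $ a = X $ i" "X $ b = - X $ i" using ab by (auto simp: cluster_def)
  ultimately have "X $ i \<bullet> X $ a = 1" "X $ i \<bullet> X $ b = - 1" by simp_all
  then have "a \<noteq> b" by auto
  moreover have "B = cluster X B (X $ i) \<union> cluster X B (- X $ i)"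
    using in_block_iff[OF B i] by (auto simp: block_rel_def cluster_def)
  then have "B = {a, b}" unfolding ab by auto
  moreover have "(q $ b \<bullet> q $ a) * (q $ a \<bullet> q $ b) \<le> q $ b \<bullet> q $ b" if "q \<in> S3n" for q
    using that Cauchy_Schwarz_ineq[of "q $ a" "q $ b"]
    by (simp add: S3n_def dot_square_norm inner_commute power2_eq_square)
  ultimately show ?thesis by auto
qed

section \<open>Absence of central configurations near the singular configuration\<close>

text \<open>Here \<open>T q\<close> is half the derivative of \<open>I1\<close> under the rotation of the block \<open>K\<close> of a body off the
  two circles, which need not be the singular block \<open>B\<close>. Near \<open>X\<close> it exceeds \<open>L > 0\<close>, and the
  external strength is below \<open>G\<close>, so the multiplier is at most \<open>G / L\<close>. With these constants fixed,
  a further shrinking of the neighbourhood contradicts the estimate for a pulled pair in \<open>B\<close>.\<close>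

lemma no_central_configuration_near_A_set:
  fixes m :: "'n::{finite,linorder} \<Rightarrow> real"
  assumes m: "\<And>i. m i > 0" and "X \<in> A_set"
  shows "\<forall>\<^sub>F q in nhds X. \<not> central_configuration m q"
proof -
  have X: "X \<in> S3n" using assms by (auto simp: A_set_def singular_set_def)
  obtain k B where k: "X $ k \<notin> S1xy \<union> S1zw" and B: "B \<in> blocks X"
    "collision_block X B \<or> antipodal_block X B"
    using assms by (auto simp: A_set_def)
  define K where "K = block_rel X `` {k}"
  have K: "K \<in> blocks X" by (simp add: K_def blocks_def quotientI)
  obtain e f where ef: "norm e \<le> 1" "norm f \<le> 1" "0 < xy_inner (X $ k) (turn e f (X $ k))"
    using ex_turn_xy_inner_pos[OF _ k] X by (auto simp: S3n_def)
  define T where "T q = (\<Sum>i\<in>K. m i * xy_inner (q $ i) (turn e f (q $ i)))" for q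
  have "0 < T X"
    unfolding T_def
  proof (rule sum_pos)
    fix i
    assume "i \<in> K"
    then have "X $ i = X $ k \<or> X $ i = - X $ k"
      by (auto simp: K_def block_rel_def)
    then have "xy_inner (X $ i) (turn e f (X $ i)) = xy_inner (X $ k) (turn e f (X $ k))"
      by (auto simp: xy_inner_def turn_def algebra_simps)
    then show "0 < m i * xy_inner (X $ i) (turn e f (X $ i))" using m ef by simp
  qed (auto simp: K_def block_rel_def)
  \<comment> \<open>Any value strictly between 0 and \<open>T X\<close> serves as \<open>L\<close>, and any above the limit as \<open>G\<close>.\<close>
  define L where "L = T X / 2"
  define G where "G = external_strength m X X + 1"
  have "isCont T X"
    unfolding T_def xy_inner_def turn_def by (intro continuous_intros)
  then have "(T \<longlongrightarrow> T X) (nhds X)"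
    by (simp add: isCont_def tendsto_at_iff_tendsto_nhds)
  then have ev_T: "\<forall>\<^sub>F q in nhds X. L < T q"
    using \<open>0 < T X\<close> by (intro order_tendstoD(1)[of T "T X"]) (simp_all add: L_def)
  have ev_G: "\<forall>\<^sub>F q in nhds X. external_strength m X q < G"
    using tendsto_external_strength[OF X, of m] by (rule order_tendstoD) (simp add: G_def)
  \<comment> \<open>Bodies in one block have inner product \<open>1\<close> or \<open>-1\<close> at \<open>X\<close>, so the left-hand side tends to 0.\<close>
  have ev_s: "\<forall>\<^sub>F q in nhds X. \<forall>a b. (a, b) \<in> block_rel X \<longrightarrow>
      (1 - (q $ a \<bullet> q $ b)\<^sup>2) * (G + 2 * (G / L) * m a) < m a * m b"
  proof (intro eventually_all_finite)
    fix a b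
    have "X $ a \<bullet> X $ a = 1"
      using X by (simp add: S3n_def dot_square_norm)
    then have "(X $ a \<bullet> X $ b)\<^sup>2 = 1" if "(a, b) \<in> block_rel X"
      using that by (auto simp: block_rel_def)
    then have "(a, b) \<in> block_rel X \<longrightarrow>
        (1 - (X $ a \<bullet> X $ b)\<^sup>2) * (G + 2 * (G / L) * m a) < m a * m b"
      using m by simp
    moreover have "open {q :: 'n config. (a, b) \<in> block_rel X \<longrightarrow>
        (1 - (q $ a \<bullet> q $ b)\<^sup>2) * (G + 2 * (G / L) * m a) < m a * m b}"
      by (intro open_Collect_imp open_Collect_less closed_Collect_const continuous_intros)
    ultimately show "\<forall>\<^sub>F q in nhds X. (a, b) \<in> block_rel X \<longrightarrow>
        (1 - (q $ a \<bullet> q $ b)\<^sup>2) * (G + 2 * (G / L) * m a) < m a * m b"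
      using eventually_nhds_in_open by fastforce
  qed
  from ev_T ev_G ev_s eventually_pulled_pair[OF X B] show ?thesis
  proof eventually_elim
    case (elim q)
    show "\<not> central_configuration m q"
    proof
      assume "central_configuration m q"
      then obtain c where crit: "critical_point (\<lambda>p. U1 m p - c * I1 m p) q"
        by (auto simp: central_configuration_def)
      then have q: "q \<in> S3n" by (simp add: critical_point_def)
      with elim obtain a b where ab: "a \<in> B" "b \<in> B" "a \<noteq> b"
        and pull: "\<And>j. j \<in> B \<Longrightarrow> j \<noteq> a \<Longrightarrow> (q $ j \<bullet> q $ a) * (q $ a \<bullet> q $ b) \<le> q $ j \<bullet> q $ b"
        by blast
      have L: "0 < L" using \<open>0 < T X\<close> by (simp add: L_def)
      have "\<bar>c\<bar> * L \<le> \<bar>c\<bar> * \<bar>T q\<bar>"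
        using elim by (intro mult_left_mono) auto
      also have "\<dots> \<le> G"
        using multiplier_bound[OF m crit K ef(1,2)] elim by (simp add: T_def)
      finally have c: "\<bar>c\<bar> \<le> G / L" using L by (simp add: pos_le_divide_eq)
      have rel: "(a, b) \<in> block_rel X" using in_block_iff[OF B(1) ab(1)] ab(2) by simp
      have "m a * m b \<le> (1 - (q $ a \<bullet> q $ b)\<^sup>2) * (external_strength m X q + 2 * \<bar>c\<bar> * m a)"
        using near_collision_estimate[OF m crit ab(3) rel] pull in_block_iff[OF B(1) ab(1)] by blast
      also have "\<dots> \<le> (1 - (q $ a \<bullet> q $ b)\<^sup>2) * (G + 2 * (G / L) * m a)"
      proof (intro mult_left_mono add_mono mult_right_mono c)
        show "0 \<le> 1 - (q $ a \<bullet> q $ b)\<^sup>2"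
          using q Cauchy_Schwarz_ineq[of "q $ a" "q $ b"] by (simp add: S3n_def dot_square_norm)
      qed (use elim m[of a] in auto)
      also have "\<dots> < m a * m b" using elim rel by blast
      finally show False by simp
    qed
  qed
qed

theorem theorem7:
  fixes m :: "'n::{finite,linorder} \<Rightarrow> real" and X :: "'n config"
  assumes "CARD('n) \<ge> 2"
    and "\<And>i. m i > 0"
    and "X \<in> A_set"
  shows "\<exists>N. openin (top_of_set S3n) N \<and> X \<in> N \<and>
    (\<forall>q\<in>N. \<not> ordinary_central_configuration m q)"
proof -
  obtain W where "open W" "X \<in> W" "\<And>q. q \<in> W \<Longrightarrow> \<not> central_configuration m q"
    using no_central_configuration_near_A_set[of m X, OF assms(2,3)] by (auto simp: eventually_nhds)
  moreover have "X \<in> S3n"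
    using assms(3) by (auto simp: A_set_def singular_set_def)
  ultimately show ?thesis
    by (intro exI[of _ "S3n \<inter> W"]) (auto simp: ordinary_central_configuration_def)
qed

end
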